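(* Let $k\ge1$ be an integer and $\epsilon>0$. Let $A$ be any randomized online algorithm for the $k$-Canadian Traveller Problem with predictions such that, on every instance whose prediction is correct, $\mathbb{E}[ALG]\le(1+\epsilon)OPT$. Then there exists an instance whose prediction is not correct, whose prediction error is at most $2$, and whose graph is path-disjoint, on which $\mathbb{E}[ALG]\ge\left(k+\frac{k}{\epsilon}\right)OPT$.
   Context: $k$-Canadian Traveller Problem ($k$-CTP) with predictions: an instance consists of a connected undirected graph $G=(V,E)$, a source $s$, a destination $t$, a nonnegative cost function $c:E\to\mathbb{R}^+$, an unknown set $B\subseteq E$ of blocked edges with $|B|\le k$ such that $G-B$ contains an $s$-$t$ path, and a predicted set $B_p\subseteq E$ of blocked edges with $|B_p|\le k$. The traveller knows $G,c,s,t,k,B_p$ in advance, starts at $s$, and learns whether an edge is blocked only upon reaching one of its endpoints; blocked edges cannot be traversed. $ALG$ is the total cost travelled (a random variable for randomized algorithms; instances are fixed in advance, i.e. oblivious adversary), $OPT$ the cost of a shortest $s$-$t$ path in $G-B$. The prediction error is $|B\triangle B_p|$; the prediction is correct iff the error is $0$. A graph is path-disjoint if all its $s$-$t$ paths are pairwise node-disjoint apart from $s$ and $t$. *)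

theory Defs
  imports "HOL-Probability.Probability"
begin

text \<open>
  Finite simple undirected graphs: vertices are natural numbers (every finite graph has such a
  labelling), edges are two-element sets of vertices, walks are nonempty vertex lists.
\<close>

definition walk_edges :: "nat list \<Rightarrow> nat set list" where
  "walk_edges p = map2 (\<lambda>u v. {u, v}) p (tl p)"

definition walk_cost :: "(nat set \<Rightarrow> real) \<Rightarrow> nat list \<Rightarrow> real" where
  "walk_cost c p = sum_list (map c (walk_edges p))"

definition paths_between :: "nat set set \<Rightarrow> nat \<Rightarrow> nat \<Rightarrow> nat list set" where
  "paths_between E u v =
     {p. p \<noteq> [] \<and> hd p = u \<and> last p = v \<and> distinct p \<and> set (walk_edges p) \<subseteq> E}"

definition connected_graph :: "nat set \<Rightarrow> nat set set \<Rightarrow> bool" where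
  "connected_graph V E \<longleftrightarrow>
     finite V \<and> V \<noteq> {} \<and> (\<forall>e\<in>E. e \<subseteq> V \<and> card e = 2) \<and>
     (\<forall>u\<in>V. \<forall>v\<in>V. paths_between E u v \<noteq> {})"

text \<open>
  The data known to the traveller in advance. The bound \<open>k\<close> is a parameter of the problem, so it
  is a parameter of the predicates below. Values of \<open>cost\<close> outside \<open>edges\<close> carry no meaning.
\<close>

record ctp_input =
  verts :: "nat set"
  edges :: "nat set set"
  source :: nat
  dest :: nat
  cost :: "nat set \<Rightarrow> real"
  predicted :: "nat set set"

text \<open>An instance is a pair of an input and the (unknown) set \<open>B\<close> of blocked edges.\<close>

definition ctp_instance :: "nat \<Rightarrow> ctp_input \<Rightarrow> nat set set \<Rightarrow> bool" where
  "ctp_instance k I B \<longleftrightarrow>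
     connected_graph (verts I) (edges I) \<and>
     source I \<in> verts I \<and> dest I \<in> verts I \<and>
     (\<forall>e\<in>edges I. 0 \<le> cost I e) \<and>
     B \<subseteq> edges I \<and> card B \<le> k \<and>
     paths_between (edges I - B) (source I) (dest I) \<noteq> {} \<and>
     predicted I \<subseteq> edges I \<and> card (predicted I) \<le> k"

definition prediction_error :: "ctp_input \<Rightarrow> nat set set \<Rightarrow> nat" where
  "prediction_error I B = card (sym_diff B (predicted I))"

definition prediction_correct :: "ctp_input \<Rightarrow> nat set set \<Rightarrow> bool" where
  "prediction_correct I B \<longleftrightarrow> prediction_error I B = 0"

definition path_disjoint :: "ctp_input \<Rightarrow> bool" where
  "path_disjoint I \<longleftrightarrow>
     (\<forall>p\<in>paths_between (edges I) (source I) (dest I).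
      \<forall>q\<in>paths_between (edges I) (source I) (dest I).
        p \<noteq> q \<longrightarrow> set p \<inter> set q \<subseteq> {source I, dest I})"

definition OPT :: "ctp_input \<Rightarrow> nat set set \<Rightarrow> real" where
  "OPT I B = Min (walk_cost (cost I) ` paths_between (edges I - B) (source I) (dest I))"

text \<open>
  A deterministic online strategy chooses the next vertex from the input, the list of vertices
  visited so far (in order), and the set of edges found to be blocked so far. When each of these
  edges was found can be read off the list of visited vertices.
\<close>

type_synonym ctp_strategy = "ctp_input \<Rightarrow> nat list \<Rightarrow> nat set set \<Rightarrow> nat"

definition revealed :: "nat set set \<Rightarrow> nat list \<Rightarrow> nat set set" where
  "revealed B w = {e \<in> B. e \<inter> set w \<noteq> {}}"

text \<open>The vertices visited within the first \<open>n\<close> moves; the traveller stops at the destination.\<close>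

primrec run :: "ctp_strategy \<Rightarrow> ctp_input \<Rightarrow> nat set set \<Rightarrow> nat \<Rightarrow> nat list" where
  "run A I B 0 = [source I]"
| "run A I B (Suc n) =
     (let w = run A I B n in
      if dest I \<in> set w then w else w @ [A I w (revealed B w)])"

definition successful :: "ctp_strategy \<Rightarrow> ctp_input \<Rightarrow> nat set set \<Rightarrow> bool" where
  "successful A I B \<longleftrightarrow>
     (\<forall>n. set (walk_edges (run A I B n)) \<subseteq> edges I - B) \<and>
     (\<exists>n. dest I \<in> set (run A I B n))"

text \<open>
  The costs of the finite runs increase to the total cost, which they attain once the destination
  has been reached.
\<close>

definition ALG :: "ctp_strategy \<Rightarrow> ctp_input \<Rightarrow> nat set set \<Rightarrow> ennreal" where
  "ALG A I B = (SUP n. ennreal (walk_cost (cost I) (run A I B n)))"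

text \<open>
  A randomized algorithm is a random deterministic strategy \<open>A \<omega>\<close>, the seed \<open>\<omega>\<close> being drawn
  from \<open>M\<close> independently of the instance. On every instance it almost surely moves along
  unblocked edges only and arrives at the destination.
\<close>

definition randomized_ctp_algorithm ::
    "nat \<Rightarrow> 'r measure \<Rightarrow> ('r \<Rightarrow> ctp_strategy) \<Rightarrow> bool" where
  "randomized_ctp_algorithm k M A \<longleftrightarrow>
     prob_space M \<and>
     (\<forall>I w R. (\<lambda>\<omega>. A \<omega> I w R) \<in> measurable M (count_space UNIV)) \<and>
     (\<forall>I B. ctp_instance k I B \<longrightarrow> (AE \<omega> in M. successful (A \<omega>) I B))"

definition expected_ALG ::
    "'r measure \<Rightarrow> ('r \<Rightarrow> ctp_strategy) \<Rightarrow> ctp_input \<Rightarrow> nat set set \<Rightarrow> ennreal" where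
  "expected_ALG M A I B = (\<integral>\<^sup>+\<omega>. ALG (A \<omega>) I B \<partial>M)"

end

theory Submission
  imports Defs
begin

text \<open>
  Take internally disjoint two-edge paths \<open>s - v - t\<close>, the first edge of cost \<open>d v\<close> and the second
  free, and let \<open>B v\<close> block the second edge of every path except the one through \<open>v\<close>. A
  deterministic strategy cannot tell \<open>B v\<close> from the situation with all second edges blocked until
  it visits \<open>v\<close>. So it explores the middle vertices in one fixed order, and its cost on \<open>B v\<close> is at
  least \<open>d v\<close> plus twice the sum of \<open>d u\<close> over all \<open>u\<close> preceding \<open>v\<close>. Weighting with \<open>d v\<close> and
  summing over \<open>v\<close> makes the order disappear: the total is at least \<open>(\<Sum>v. d v)\<^sup>2\<close>, and
  this passes to expectations. With \<open>k\<close> paths of cost \<open>1\<close>, one path \<open>x\<close> of cost \<open>L = k / \<epsilon>\<close> and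
  the prediction \<open>B x\<close>, consistency bounds the term of \<open>x\<close> by \<open>L (1 + \<epsilon>) L\<close>. The \<open>k\<close> other
  terms sum to at least \<open>(k + L)\<^sup>2 - (1 + \<epsilon>) L\<^sup>2 = k (k + k / \<epsilon>)\<close>, so one of them is large enough.
\<close>

section \<open>Walks, runs and measurability of the cost\<close>

lemma walk_edges_simps [simp]:
  "walk_edges [] = []" "walk_edges [u] = []"
  "walk_edges (u # v # p) = {u, v} # walk_edges (v # p)"
  by (simp_all add: walk_edges_def)

lemma walk_edges_snoc: "p \<noteq> [] \<Longrightarrow> walk_edges (p @ [y]) = walk_edges p @ [{last p, y}]"
proof (induction p)
  case (Cons a p)
  then show ?case by (cases p) auto
qed simp

lemma walk_cost_snoc: "p \<noteq> [] \<Longrightarrow> walk_cost c (p @ [y]) = walk_cost c p + c {last p, y}"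
  by (simp add: walk_cost_def walk_edges_snoc)

lemma run_nonempty [simp]: "run a I B n \<noteq> []"
  by (induction n) (auto simp: Let_def)

lemma hd_run [simp]: "hd (run a I B n) = source I"
  by (induction n) (auto simp: Let_def hd_append)

lemma set_run_mono: "m \<le> n \<Longrightarrow> set (run a I B m) \<subseteq> set (run a I B n)"
  by (rule lift_Suc_mono_le[of "\<lambda>n. set (run a I B n)"]) (auto simp: Let_def)

text \<open>The list visited after \<open>n\<close> moves ranges over a countable type, so it
  suffices to treat one move from each fixed list \<open>w\<close>, where measurability is
  assumed.\<close>

lemma measurable_run:
  assumes "\<And>I w R. (\<lambda>\<omega>. A \<omega> I w R) \<in> measurable M (count_space UNIV)"
  shows "(\<lambda>\<omega>. run (A \<omega>) I B n) \<in> measurable M (count_space UNIV)"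
proof (induction n)
  case (Suc n)
  have step: "(\<lambda>\<omega>. if dest I \<in> set w then w else w @ [A \<omega> I w (revealed B w)])
      \<in> measurable M (count_space UNIV)" for w
    using measurable_compose[OF assms, of "\<lambda>y. w @ [y]" "count_space UNIV" I w "revealed B w"]
    by (cases "dest I \<in> set w") simp_all
  show ?case
    using measurable_compose_countable[OF step Suc] by (simp add: Let_def)
qed simp

lemma borel_measurable_ALG:
  assumes "\<And>I w R. (\<lambda>\<omega>. A \<omega> I w R) \<in> measurable M (count_space UNIV)"
  shows "(\<lambda>\<omega>. ALG (A \<omega>) I B) \<in> borel_measurable M"
  unfolding ALG_def
  by (intro borel_measurable_SUP measurable_compose[OF measurable_run[OF assms]]) simp_all

text \<open>Of two distinct elements exactly one precedes the other, by injectivity of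
  \<open>\<tau>\<close>, so each product \<open>d v * d u\<close> of the expanded square is caught
  by exactly one of the two orders. The diagonal is caught by both and is subtracted once.\<close>

lemma weighted_prefix_sums:
  fixes d :: "'a \<Rightarrow> real" and \<tau> :: "'a \<Rightarrow> 'b::linorder"
  assumes "finite W" and "inj_on \<tau> W"
  shows "(\<Sum>v\<in>W. d v * (2 * (\<Sum>u | u \<in> W \<and> \<tau> u \<le> \<tau> v. d u) - d v)) = (\<Sum>v\<in>W. d v)\<^sup>2"
proof -
  let ?le = "\<lambda>v u. if \<tau> u \<le> \<tau> v then d v * d u else 0"
  have prefix: "d v * (\<Sum>u | u \<in> W \<and> \<tau> u \<le> \<tau> v. d u) = (\<Sum>u\<in>W. ?le v u)" for v
    by (auto simp: sum_distrib_left sum.inter_filter assms(1) intro!: sum.cong)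
  have swap: "(\<Sum>v\<in>W. \<Sum>u\<in>W. ?le v u) = (\<Sum>v\<in>W. \<Sum>u\<in>W. ?le u v)"
    by (rule sum.swap)
  have "(\<Sum>v\<in>W. d v)\<^sup>2 = (\<Sum>v\<in>W. \<Sum>u\<in>W. d v * d u)"
    by (simp add: power2_eq_square sum_product)
  also have "\<dots> = (\<Sum>v\<in>W. \<Sum>u\<in>W. ?le v u + ?le u v - (if u = v then d v * d v else 0))"
    using inj_onD[OF assms(2)]
    by (intro sum.cong refl) (auto simp: not_le)
  also have "\<dots> = 2 * (\<Sum>v\<in>W. \<Sum>u\<in>W. ?le v u) - (\<Sum>v\<in>W. d v * d v)"
    using swap by (simp add: sum.distrib sum_subtractf assms(1))
  finally show ?thesis
    by (simp add: right_diff_distrib sum_subtractf prefix[symmetric] sum_distrib_left mult_ac)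
qed

section \<open>The graph of parallel two-edge paths and its instances\<close>

locale parallel_paths =
  fixes W :: "nat set" and d :: "nat \<Rightarrow> real" and P :: "nat set set"
  assumes finite_W: "finite W" and W_nonempty: "W \<noteq> {}"
    and ends_notin_W: "0 \<notin> W" "Suc 0 \<notin> W"
    and d_nonneg: "\<And>v. 0 \<le> d v"
begin

lemma W_pos [simp]: "v \<in> W \<Longrightarrow> 0 < v"
  using ends_notin_W by (cases v) auto

definition E :: "nat set set" where
  "E = (\<lambda>v. {0, v}) ` W \<union> (\<lambda>v. {v, 1}) ` W"

text \<open>Middle vertices are positive, so \<open>Max e\<close> recovers \<open>v\<close> from the
  edge \<open>{0, v}\<close>.\<close>

definition inp :: ctp_input where
  "inp = \<lparr>verts = {0, 1} \<union> W, edges = E, source = 0, dest = 1,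
     cost = (\<lambda>e. if 0 \<in> e then d (Max e) else 0), predicted = P\<rparr>"

text \<open>As a blocked set, \<open>exits\<close> leaves no route to \<open>1\<close> and so gives
  no instance, but \<open>run\<close> is defined on it all the same: it supplies one reference run
  for all \<open>v\<close>.\<close>

definition exits :: "nat set set" where
  "exits = (\<lambda>v. {v, 1}) ` W"

definition B :: "nat \<Rightarrow> nat set set" where
  "B v = exits - {{v, 1}}"

lemma inp_simps [simp]:
  "verts inp = {0, 1} \<union> W" "edges inp = E" "source inp = 0" "dest inp = 1" "predicted inp = P"
  by (simp_all add: inp_def)

lemma cost_inp:
  "v \<in> W \<Longrightarrow> cost inp {0, v} = d v" "v \<in> W \<Longrightarrow> cost inp {v, 0} = d v"
  "v \<in> W \<Longrightarrow> cost inp {v, Suc 0} = 0"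
proof -
  show *: "cost inp {0, v} = d v" if "v \<in> W" for v
    by (simp add: inp_def)
  show "cost inp {v, 0} = d v" if "v \<in> W" for v
    using *[OF that] by (simp only: insert_commute)
  show "cost inp {v, Suc 0} = 0" if "v \<in> W" for v
    using W_pos[OF that] by (simp add: inp_def)
qed

lemma edge_iff:
  "{u, v} \<in> E \<longleftrightarrow> (u \<in> {0, 1} \<and> v \<in> W) \<or> (u \<in> W \<and> v \<in> {0, 1})"
  unfolding E_def Un_iff image_iff doubleton_eq_iff by blast

lemma exit_iff:
  "{u, v} \<in> exits \<longleftrightarrow> (u = 1 \<and> v \<in> W) \<or> (u \<in> W \<and> v = 1)"
  unfolding exits_def image_iff doubleton_eq_iff by blast

lemma edge_minus_B_iff:
  assumes "v \<in> W"
  shows "{a, b} \<in> E - B v \<longleftrightarrow>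
    (a = 0 \<and> b \<in> W) \<or> (a \<in> W \<and> b = 0) \<or> (a = 1 \<and> b = v) \<or> (a = v \<and> b = 1)"
proof -
  have "0 \<notin> W" "1 \<notin> W" "(0::nat) \<noteq> 1" using ends_notin_W by simp_all
  then show ?thesis
    unfolding B_def Diff_iff edge_iff exit_iff insert_iff empty_iff doubleton_eq_iff
    using assms by metis
qed

text \<open>Edges join only ends to middle vertices, so distinctness forces the second move into
  \<open>1\<close>, and a path ending in \<open>1\<close> cannot continue from there.\<close>

lemma st_paths: "paths_between E 0 1 \<subseteq> (\<lambda>v. [0, v, 1]) ` W"
proof
  fix p assume "p \<in> paths_between E 0 1"
  then have p: "p \<noteq> []" "hd p = 0" "last p = 1" "distinct p" "set (walk_edges p) \<subseteq> E"
    by (auto simp: paths_between_def)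
  obtain q where q: "p = 0 # q" using p(1,2) by (cases p) auto
  obtain v r where r: "q = v # r" using p(3) q by (cases q) auto
  have v: "v \<in> W" using p(5) q r edge_iff[of 0 v] ends_notin_W by auto
  obtain y r' where y: "r = y # r'" using p(3) q r v ends_notin_W by (cases r) auto
  have "y = 1" using p(4,5) q r y v edge_iff[of v y] ends_notin_W by auto
  moreover have "r' = []"
  proof (rule ccontr)
    assume "r' \<noteq> []"
    then have "last p \<in> set r'" using q r y by simp
    then show False using p(3,4) q r y \<open>y = 1\<close> by auto
  qed
  ultimately show "p \<in> (\<lambda>v. [0, v, 1]) ` W" using q r y v by auto
qed

lemma st_paths_minus_B: "v \<in> W \<Longrightarrow> paths_between (E - B v) 0 1 = {[0, v, 1]}"
proof
  assume v: "v \<in> W"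
  show "{[0, v, 1]} \<subseteq> paths_between (E - B v) 0 1"
    using v ends_notin_W edge_minus_B_iff[OF v, of 0 v] edge_minus_B_iff[OF v, of v 1]
    by (auto simp: paths_between_def)
  have "paths_between (E - B v) 0 1 \<subseteq> paths_between E 0 1"
    by (auto simp: paths_between_def)
  then have "paths_between (E - B v) 0 1 \<subseteq> (\<lambda>v. [0, v, 1]) ` W"
    using st_paths by blast
  moreover have "u = v" if "[0, u, 1] \<in> paths_between (E - B v) 0 1" "u \<in> W" for u
    using that v ends_notin_W edge_minus_B_iff[OF v, of u 1] by (auto simp: paths_between_def)
  ultimately show "paths_between (E - B v) 0 1 \<subseteq> {[0, v, 1]}" by blast
qed

lemma path_disjoint_inp: "path_disjoint inp"
  unfolding path_disjoint_def inp_simps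
proof (intro ballI impI)
  fix p q assume "p \<in> paths_between E 0 1" "q \<in> paths_between E 0 1"
  then have "p \<in> (\<lambda>v. [0, v, 1]) ` W" "q \<in> (\<lambda>v. [0, v, 1]) ` W"
    using st_paths by (simp_all only: subsetD)
  moreover assume "p \<noteq> q"
  ultimately show "set p \<inter> set q \<subseteq> {0, 1}" by auto
qed

lemma OPT_B: "v \<in> W \<Longrightarrow> OPT inp (B v) = d v"
  using st_paths_minus_B[of v] cost_inp(1,3)[of v]
  by (simp add: OPT_def walk_cost_def)

lemma connected: "connected_graph ({0, 1} \<union> W) E"
proof -
  obtain w where w: "w \<in> W" using W_nonempty by blast
  have "paths_between E u v \<noteq> {}" if uv: "u \<in> {0, 1} \<union> W" "v \<in> {0, 1} \<union> W" for u v
  proof -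
    consider "u = v" | "{u, v} = {0, 1}" | "u \<in> {0, 1}" "v \<in> W" | "u \<in> W" "v \<in> {0, 1}"
      | "u \<in> W" "v \<in> W" "u \<noteq> v"
      using uv by auto
    \<comment> \<open>The two ends are linked through \<open>w\<close>, two middle vertices through
      \<open>0\<close>.\<close>
    then have "[u] \<in> paths_between E u v \<or> [u, v] \<in> paths_between E u v
        \<or> [u, w, v] \<in> paths_between E u v \<or> [u, 0, v] \<in> paths_between E u v"
      using w ends_notin_W
      by cases (auto simp: paths_between_def edge_iff doubleton_eq_iff)
    then show ?thesis by blast
  qed
  moreover have "e \<subseteq> {0, 1} \<union> W \<and> card e = 2" if "e \<in> E" for e
    using that ends_notin_W by (auto simp: E_def card_insert_if)
  ultimately show ?thesis
    using finite_W by (simp add: connected_graph_def)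
qed

lemma card_exits: "card exits = card W"
  unfolding exits_def by (rule card_image) (auto simp: inj_on_def doubleton_eq_iff)

lemma finite_exits: "finite exits"
  by (simp add: exits_def finite_W)

lemma card_B: "v \<in> W \<Longrightarrow> card (B v) = card W - 1"
  using card_exits finite_exits by (simp add: B_def exits_def)

text \<open>The budget is \<open>card W - 1\<close> because \<open>B v\<close> blocks all exits but
  one.\<close>

lemma instance_B:
  assumes "v \<in> W" "P \<subseteq> exits" "card P \<le> card W - 1"
  shows "ctp_instance (card W - 1) inp (B v)"
proof -
  have "exits \<subseteq> E" by (auto simp: exits_def E_def)
  moreover have "\<forall>e. 0 \<le> cost inp e" using d_nonneg by (simp add: inp_def)
  ultimately show ?thesis
    using assms connected st_paths_minus_B[OF assms(1)] card_B[OF assms(1)]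
    by (auto simp: ctp_instance_def B_def)
qed

text \<open>Each set blocks the exit that the other leaves open; this is the source of the error
  bound \<open>2\<close>.\<close>

lemma card_sym_diff_B:
  assumes "u \<in> W" "v \<in> W" "u \<noteq> v"
  shows "card (sym_diff (B u) (B v)) = 2"
proof -
  have "sym_diff (B u) (B v) = {{u, 1}, {v, 1}}"
    using assms ends_notin_W by (auto simp: B_def exits_def doubleton_eq_iff)
  moreover have "{u, 1} \<noteq> {v, 1}" using assms(3) by (auto simp: doubleton_eq_iff)
  ultimately show ?thesis by simp
qed

text \<open>Apart from the vertex it ends at, a walk has crossed the edge to each visited middle vertex
  at least twice; the term \<open>d (last p)\<close> accounts for the return trip still to be made.\<close>

lemma walk_cost_ge:
  assumes "p \<noteq> []" "hd p = 0" "1 \<notin> set p" "set (walk_edges p) \<subseteq> E"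
  shows "2 * (\<Sum>u\<in>set p \<inter> W. d u) \<le> walk_cost (cost inp) p + (if last p \<in> W then d (last p) else 0)"
  using assms
proof (induction p rule: rev_nonempty_induct)
  case (single x)
  then show ?case using ends_notin_W by (simp add: walk_cost_def)
next
  case (snoc y p)
  let ?l = "last p"
  have "{?l, y} \<in> E" "?l \<in> set p"
    using snoc.hyps snoc.prems by (auto simp: walk_edges_snoc)
  then have step: "?l = 0 \<and> y \<in> W \<or> ?l \<in> W \<and> y = 0"
    using snoc.prems by (auto simp: edge_iff)
  have IH: "2 * (\<Sum>u\<in>set p \<inter> W. d u) \<le> walk_cost (cost inp) p + (if ?l \<in> W then d ?l else 0)"
    using snoc by (auto simp: walk_edges_snoc)
  from step show ?case
  proof
    assume l: "?l = 0 \<and> y \<in> W"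
    \<comment> \<open>An inequality, since \<open>y\<close> may have been visited before. The
      crossing pays one \<open>d y\<close>, the pending return the other.\<close>
    have "(\<Sum>u\<in>insert y (set p \<inter> W). d u) \<le> d y + (\<Sum>u\<in>set p \<inter> W. d u)"
      using d_nonneg[of y] by (cases "y \<in> set p \<inter> W") (auto simp: insert_absorb)
    then show ?thesis
      using l IH snoc.hyps ends_notin_W by (simp add: walk_cost_snoc cost_inp)
  next
    \<comment> \<open>The return to \<open>0\<close> turns the pending term into actual
      cost.\<close>
    assume l: "?l \<in> W \<and> y = 0"
    then show ?thesis
      using IH snoc.hyps ends_notin_W by (simp add: walk_cost_snoc cost_inp)
  qed
qed

section \<open>Runs under \<open>B v\<close> compared with the reference run\<close>

text \<open>The only unblocked edge at \<open>1\<close> comes from \<open>v\<close>.\<close>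

lemma dest_needs_exit:
  assumes "v \<in> W" "p \<noteq> []" "hd p = 0" "v \<notin> set p" "set (walk_edges p) \<subseteq> E - B v"
  shows "1 \<notin> set p"
  using assms(2-)
proof (induction p rule: rev_nonempty_induct)
  case (snoc y p)
  have "{last p, y} \<in> E - B v" "last p \<in> set p"
    using snoc.hyps snoc.prems by (auto simp: walk_edges_snoc)
  then have "y \<noteq> 1"
    using snoc.prems edge_minus_B_iff[OF assms(1)] ends_notin_W by auto
  then show ?case using snoc by (auto simp: walk_edges_snoc)
qed simp

text \<open>The blocked sets differ only in \<open>{v, 1}\<close>, which is revealed at
  \<open>v\<close> or at \<open>1\<close>, where the run stops. The move made from a list without
  \<open>v\<close> is still the same, so the runs agree up to and including the first arrival at
  \<open>v\<close>.\<close>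

lemma run_B_eq_Suc:
  assumes "v \<notin> set (run a inp exits n)"
  shows "run a inp (B v) n = run a inp exits n \<and>
    run a inp (B v) (Suc n) = run a inp exits (Suc n)"
proof -
  have *: "run a inp (B v) (Suc n) = run a inp exits (Suc n)"
    if "run a inp (B v) n = run a inp exits n" "v \<notin> set (run a inp exits n)" for n
  proof (cases "1 \<in> set (run a inp exits n)")
    case False
    then have "revealed (B v) (run a inp exits n) = revealed exits (run a inp exits n)"
      using that(2) by (auto simp: revealed_def B_def)
    then show ?thesis using that(1) by (simp add: Let_def)
  qed (use that(1) in simp)
  have "run a inp (B v) n = run a inp exits n"
    using assms
  proof (induction n)
    case (Suc n)
    then have "v \<notin> set (run a inp exits n)"
      using set_run_mono[of n "Suc n" a inp exits] by auto
    then show ?case using * Suc.IH by blast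
  qed simp
  then show ?thesis using * assms by blast
qed

text \<open>Measured on the reference run, so that a single order serves all \<open>B v\<close>. It
  is meaningful only if \<open>v\<close> is visited there, which success on \<open>B v\<close>
  guarantees.\<close>

definition \<tau> :: "ctp_strategy \<Rightarrow> nat \<Rightarrow> nat" where
  "\<tau> a v = (LEAST n. v \<in> set (run a inp exits n))"

text \<open>Reaching \<open>1\<close> under \<open>B v\<close> requires \<open>v\<close>, and until
  then the run equals the reference run; hence \<open>v\<close> occurs there, as the last vertex of
  the common prefix.\<close>

lemma first_visit:
  assumes v: "v \<in> W" and succ: "successful a inp (B v)"
  shows "v \<in> set (run a inp exits (\<tau> a v))"
    and "run a inp (B v) (\<tau> a v) = run a inp exits (\<tau> a v)"
    and "last (run a inp exits (\<tau> a v)) = v"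
    and "1 \<notin> set (run a inp exits (\<tau> a v))"
proof -
  have walk: "set (walk_edges (run a inp (B v) n)) \<subseteq> E - B v" for n
    using succ by (simp add: successful_def)
  obtain n where "1 \<in> set (run a inp (B v) n)"
    using succ by (auto simp: successful_def)
  then have "v \<in> set (run a inp (B v) n)"
    using dest_needs_exit[OF v _ _ _ walk] by fastforce
  then have "v \<in> set (run a inp exits n)"
    using run_B_eq_Suc[of v a n] by metis
  then show visit: "v \<in> set (run a inp exits (\<tau> a v))"
    unfolding \<tau>_def by (rule LeastI)
  have "v \<notin> set (run a inp exits 0)" using v ends_notin_W by auto
  then obtain m where m: "\<tau> a v = Suc m"
    using visit by (cases "\<tau> a v") auto
  have before: "v \<notin> set (run a inp exits m)"
    using m unfolding \<tau>_def by (metis lessI not_less_Least)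
  show "run a inp (B v) (\<tau> a v) = run a inp exits (\<tau> a v)"
    using run_B_eq_Suc[OF before] m by metis
  \<comment> \<open>The destination is not yet reached, so the next move really appends a vertex,
    which must be \<open>v\<close>.\<close>
  have "1 \<notin> set (run a inp exits m)"
    using dest_needs_exit[OF v _ _ _ walk, of m] before run_B_eq_Suc[OF before] by simp
  moreover from this have "run a inp exits (\<tau> a v) = run a inp exits m @ [v]"
    using visit before m by (auto simp: Let_def)
  ultimately show "last (run a inp exits (\<tau> a v)) = v" "1 \<notin> set (run a inp exits (\<tau> a v))"
    using v ends_notin_W by auto
qed

text \<open>At the first arrival in \<open>v\<close>, every \<open>u\<close> with
  \<open>\<tau> a u \<le> \<tau> a v\<close> has been visited and only the return trip from
  \<open>v\<close> is outstanding, hence \<open>- d v\<close>.\<close>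

lemma ALG_B_ge:
  assumes succ: "\<And>v. v \<in> W \<Longrightarrow> successful a inp (B v)" and v: "v \<in> W"
  shows "ennreal (2 * (\<Sum>u | u \<in> W \<and> \<tau> a u \<le> \<tau> a v. d u) - d v) \<le> ALG a inp (B v)"
proof -
  let ?p = "run a inp exits (\<tau> a v)"
  note fv = first_visit[OF v succ[OF v]]
  have "set (walk_edges (run a inp (B v) (\<tau> a v))) \<subseteq> E"
    using succ[OF v] by (auto simp: successful_def)
  then have "set (walk_edges ?p) \<subseteq> E" by (simp only: fv(2))
  then have "2 * (\<Sum>u\<in>set ?p \<inter> W. d u) \<le> walk_cost (cost inp) ?p + d v"
    using walk_cost_ge[of ?p] fv v by simp
  moreover have "{u. u \<in> W \<and> \<tau> a u \<le> \<tau> a v} \<subseteq> set ?p \<inter> W"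
    using first_visit(1)[OF _ succ] set_run_mono by blast
  then have "(\<Sum>u | u \<in> W \<and> \<tau> a u \<le> \<tau> a v. d u) \<le> (\<Sum>u\<in>set ?p \<inter> W. d u)"
    by (rule sum_mono2[rotated]) (use d_nonneg in auto)
  ultimately have "2 * (\<Sum>u | u \<in> W \<and> \<tau> a u \<le> \<tau> a v. d u) - d v \<le> walk_cost (cost inp) ?p"
    by linarith
  then have "ennreal (2 * (\<Sum>u | u \<in> W \<and> \<tau> a u \<le> \<tau> a v. d u) - d v)
      \<le> ennreal (walk_cost (cost inp) (run a inp (B v) (\<tau> a v)))"
    by (simp add: fv(2) ennreal_leI)
  also have "\<dots> \<le> ALG a inp (B v)"
    unfolding ALG_def by (rule SUP_upper) simp
  finally show ?thesis .
qed

section \<open>Summation over the instances and expectation\<close>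

lemma weighted_ALG_ge:
  assumes succ: "\<And>v. v \<in> W \<Longrightarrow> successful a inp (B v)"
  shows "ennreal ((\<Sum>v\<in>W. d v)\<^sup>2) \<le> (\<Sum>v\<in>W. ennreal (d v) * ALG a inp (B v))"
proof -
  let ?s = "\<lambda>v. 2 * (\<Sum>u | u \<in> W \<and> \<tau> a u \<le> \<tau> a v. d u) - d v"
  \<comment> \<open>The reference run at time \<open>\<tau> a v\<close> ends in \<open>v\<close>, so
    equal times mean equal vertices.\<close>
  have inj: "inj_on (\<tau> a) W"
    using first_visit(3)[OF _ succ] by (metis inj_onI)
  \<comment> \<open>Nonnegativity carries the real identity over to \<open>ennreal\<close>.\<close>
  have "0 \<le> ?s v" if "v \<in> W" for v
  proof -
    have "d v \<le> (\<Sum>u | u \<in> W \<and> \<tau> a u \<le> \<tau> a v. d u)"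
      using that finite_W d_nonneg by (intro member_le_sum) auto
    then show ?thesis using d_nonneg[of v] by linarith
  qed
  then have "ennreal ((\<Sum>v\<in>W. d v)\<^sup>2) = (\<Sum>v\<in>W. ennreal (d v) * ennreal (?s v))"
    using d_nonneg
    by (simp add: weighted_prefix_sums[OF finite_W inj, symmetric] ennreal_mult[symmetric])
  also have "\<dots> \<le> (\<Sum>v\<in>W. ennreal (d v) * ALG a inp (B v))"
    by (intro sum_mono mult_left_mono ALG_B_ge succ) auto
  finally show ?thesis .
qed

lemma weighted_expected_ALG_ge:
  assumes A: "randomized_ctp_algorithm (card W - 1) M A"
    and P: "P \<subseteq> exits" "card P \<le> card W - 1"
  shows "ennreal ((\<Sum>v\<in>W. d v)\<^sup>2) \<le> (\<Sum>v\<in>W. ennreal (d v) * expected_ALG M A inp (B v))"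
proof -
  interpret prob_space M using A by (simp add: randomized_ctp_algorithm_def)
  have meas: "(\<lambda>\<omega>. ALG (A \<omega>) inp (B v)) \<in> borel_measurable M" for v
    using A by (intro borel_measurable_ALG) (simp add: randomized_ctp_algorithm_def)
  \<comment> \<open>There are finitely many instances, so almost every seed succeeds on all of them
    at once.\<close>
  have "AE \<omega> in M. \<forall>v\<in>W. successful (A \<omega>) inp (B v)"
    using A instance_B[OF _ P] finite_W
    by (intro AE_finite_allI) (auto simp: randomized_ctp_algorithm_def)
  then have "(\<integral>\<^sup>+\<omega>. ennreal ((\<Sum>v\<in>W. d v)\<^sup>2) \<partial>M)
      \<le> (\<integral>\<^sup>+\<omega>. (\<Sum>v\<in>W. ennreal (d v) * ALG (A \<omega>) inp (B v)) \<partial>M)"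
    by (intro nn_integral_mono_AE) (auto elim!: eventually_mono intro: weighted_ALG_ge)
  also have "\<dots> = (\<Sum>v\<in>W. ennreal (d v) * expected_ALG M A inp (B v))"
    using meas by (simp add: nn_integral_sum nn_integral_cmult expected_ALG_def)
  finally show ?thesis by (simp add: emeasure_space_1)
qed

end

section \<open>Choice of costs and prediction\<close>

theorem theorem3:
  fixes k :: nat and \<epsilon> :: real
    and M :: "'r measure" and A :: "'r \<Rightarrow> ctp_strategy"
  assumes "k \<ge> 1" and "\<epsilon> > 0"
    and "randomized_ctp_algorithm k M A"
    and "\<And>I B. ctp_instance k I B \<Longrightarrow> prediction_correct I B \<Longrightarrow>
           expected_ALG M A I B \<le> ennreal ((1 + \<epsilon>) * OPT I B)"
  shows "\<exists>I B. ctp_instance k I B \<and>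
           \<not> prediction_correct I B \<and> prediction_error I B \<le> 2 \<and>
           path_disjoint I \<and> 0 < OPT I B \<and>
           expected_ALG M A I B \<ge> ennreal ((real k + real k / \<epsilon>) * OPT I B)"
proof -
  \<comment> \<open>Chosen so that \<open>\<epsilon> * L = k\<close>, which makes the final balance
    exact.\<close>
  define L where "L = real k / \<epsilon>"
  \<comment> \<open>The ends take \<open>0\<close> and \<open>1\<close>, so the \<open>k\<close>
    unit-cost middle vertices start at \<open>2\<close> and \<open>x\<close> follows them.\<close>
  define x where "x = k + 2"
  define C where "C = {2..<k + 2}"
  define d where "d v = (if v = x then L else 1)" for v
  define P where "P = (\<lambda>v. {v, 1}) ` C"
  have L: "L > 0" "\<epsilon> * L = k" using assms(1,2) by (auto simp: L_def)
  have C: "finite C" "card C = k" "x \<notin> C" by (auto simp: C_def x_def)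
  interpret parallel_paths "insert x C" d P
    by unfold_locales (use L in \<open>auto simp: C_def x_def d_def\<close>)
  have card_W: "card (insert x C) - 1 = k" using C by simp
  \<comment> \<open>The prediction leaves open just the path through \<open>x\<close>, so it is
    correct on \<open>B x\<close>.\<close>
  have P_eq: "P = B x"
    using C(3) by (auto simp: P_def B_def exits_def doubleton_eq_iff)
  have P: "P \<subseteq> exits" "card P \<le> card (insert x C) - 1"
    using card_B[of x] by (auto simp: P_eq B_def)
  have inst: "ctp_instance k inp (B v)" if "v \<in> insert x C" for v
    using instance_B[OF that P] card_W by simp
  let ?e = "\<lambda>v. expected_ALG M A inp (B v)"
  have err: "prediction_error inp (B v) = card (sym_diff (B v) (B x))" for v
    by (simp add: prediction_error_def flip: P_eq)
  then have "prediction_correct inp (B x)"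
    by (simp add: prediction_correct_def)
  then have ex: "?e x \<le> ennreal ((1 + \<epsilon>) * L)"
    using assms(4)[OF inst[of x]] OPT_B[of x] by (simp add: d_def)
  \<comment> \<open>On \<open>C\<close> the optimum is \<open>1\<close>, so \<open>k + L\<close> is
    the required ratio. If every \<open>v\<close> stayed below it, the weighted sum would fall below
    \<open>(k + L)\<^sup>2\<close>.\<close>
  have "\<exists>v\<in>C. ?e v \<ge> ennreal (k + L)"
  proof (rule ccontr)
    assume "\<not> ?thesis"
    then have less: "?e v < ennreal (k + L)" if "v \<in> C" for v using that by (auto simp: not_le)
    let ?r = "\<lambda>v. enn2real (?e v)"
    \<comment> \<open>All expectations are finite, by \<open>less\<close> on \<open>C\<close> and by
      consistency at \<open>x\<close>, so the argument moves to the reals.\<close>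
    have fin: "?e v = ennreal (?r v)" if "v \<in> insert x C" for v
      using that less[of v] ex
      by (auto simp: top_unique less_top[symmetric] intro!: ennreal_enn2real[symmetric])
    have "ennreal ((\<Sum>v\<in>insert x C. d v)\<^sup>2) \<le> (\<Sum>v\<in>insert x C. ennreal (d v) * ?e v)"
      using weighted_expected_ALG_ge[OF _ P] assms(3) card_W by simp
    also have "\<dots> = (\<Sum>v\<in>insert x C. ennreal (d v * ?r v))"
      using fin d_nonneg by (intro sum.cong refl) (simp add: ennreal_mult)
    also have "\<dots> = ennreal (\<Sum>v\<in>insert x C. d v * ?r v)"
      using d_nonneg by (intro sum_ennreal) simp
    finally have le: "(\<Sum>v\<in>insert x C. d v)\<^sup>2 \<le> (\<Sum>v\<in>insert x C. d v * ?r v)"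
      using d_nonneg by (subst (asm) ennreal_le_iff) (auto intro!: sum_nonneg)
    have d_C: "v \<in> C \<Longrightarrow> d v = 1" for v using C(3) by (auto simp: d_def)
    have "(k + L)\<^sup>2 \<le> L * ?r x + (\<Sum>v\<in>C. ?r v)"
      using le C d_C by (simp add: d_def add.commute)
    also have "L * ?r x \<le> L * ((1 + \<epsilon>) * L)"
      using ex fin[of x] L assms(2) by (intro mult_left_mono) (simp_all add: enn2real_leI)
    \<comment> \<open>Strict because \<open>C\<close> is nonempty, by
      \<open>k \<ge> 1\<close>.\<close>
    also have "(\<Sum>v\<in>C. ?r v) < (\<Sum>v\<in>C. k + L)"
    proof (rule sum_strict_mono)
      fix v assume v: "v \<in> C"
      have "ennreal (?r v) < ennreal (k + L)" using less[OF v] fin[of v] v by simp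
      then show "?r v < k + L" by (simp add: ennreal_less_iff)
    qed (use C assms(1) in auto)
    also have "(\<Sum>v\<in>C. k + L) = k * (k + L)" using C by simp
    \<comment> \<open>With \<open>\<epsilon> * L = k\<close> the first term is
      \<open>L\<^sup>2 + k * L\<close>, and the second completes the square.\<close>
    also have "L * ((1 + \<epsilon>) * L) + k * (k + L) = (k + L)\<^sup>2"
      unfolding L(2)[symmetric] by algebra
    finally show False by simp
  qed
  then obtain v where v: "v \<in> C" "?e v \<ge> ennreal (k + L)" by blast
  then have "v \<noteq> x" using C by auto
  then have "prediction_error inp (B v) = 2"
    using card_sym_diff_B[of v x] v by (simp add: err)
  moreover have "OPT inp (B v) = 1" using OPT_B[of v] v \<open>v \<noteq> x\<close> by (simp add: d_def)
  ultimately show ?thesis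
    using inst[of v] v path_disjoint_inp
    by (intro exI[of _ inp] exI[of _ "B v"]) (simp add: prediction_correct_def L_def)
qed

end
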